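(* Each infinite compact Hausdorff space $X$ contains a point $x\in X$ with network character $\mathrm{nw}_\chi(x)=\aleph_0$.
   Context: Network character: a family $\mathcal N$ of subsets of $X$ is an i-network at $x\in X$ if every $N\in\mathcal N$ is infinite and each neighborhood of $x$ in $X$ contains some $N\in\mathcal N$. If every neighborhood of $x$ is infinite, $\mathrm{nw}_\chi(x)=\mathrm{nw}_\chi(x;X)$ is the smallest cardinality of an i-network at $x$; if some neighborhood of $x$ is finite, $\mathrm{nw}_\chi(x)=1$. *)

theory Defs
  imports "HOL-Analysis.Analysis"
begin

unbundle cardinal_syntax

definition neighborhood :: "'a topology \<Rightarrow> 'a \<Rightarrow> 'a set \<Rightarrow> bool" where
  "neighborhood X x V \<longleftrightarrow> V \<subseteq> topspace X \<and> x \<in> X interior_of V"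

definition i_network :: "'a topology \<Rightarrow> 'a \<Rightarrow> 'a set set \<Rightarrow> bool" where
  "i_network X x \<N> \<longleftrightarrow>
     \<N> \<subseteq> Pow (topspace X) \<and> (\<forall>N\<in>\<N>. infinite N) \<and>
     (\<forall>V. neighborhood X x V \<longrightarrow> (\<exists>N\<in>\<N>. N \<subseteq> V))"

(* A cardinal is represented by a cardinal order, determined up to =o; it is carried by
   a set of sets of points, since it is the cardinality of a family of subsets of X. The
   cardinal 1 is that of an arbitrary one-element family. *)
definition nw_chi :: "'a topology \<Rightarrow> 'a \<Rightarrow> 'a set rel" where
  "nw_chi X x =
     (if \<forall>V. neighborhood X x V \<longrightarrow> infinite V
      then (SOME \<kappa>. (\<exists>\<N>. i_network X x \<N> \<and> \<kappa> = |\<N>| ) \<and>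
                     (\<forall>\<N>. i_network X x \<N> \<longrightarrow> \<kappa> \<le>o |\<N>| ))
      else |{{}}| )"

lemma nw_chi_least:
  assumes "\<forall>V. neighborhood X x V \<longrightarrow> infinite V"
  shows "(\<exists>\<N>. i_network X x \<N> \<and> nw_chi X x = |\<N>| ) \<and>
         (\<forall>\<N>. i_network X x \<N> \<longrightarrow> nw_chi X x \<le>o |\<N>| )"
proof -
  have "i_network X x {V. neighborhood X x V}"
    using assms by (auto simp: i_network_def neighborhood_def)
  then have "{|\<N>| |\<N>. i_network X x \<N>} \<noteq> {}"
    by blast
  moreover have "\<forall>r \<in> {|\<N>| |\<N>. i_network X x \<N>}. Card_order r"
    using card_of_Card_order by auto
  ultimately have "\<exists>r \<in> {|\<N>| |\<N>. i_network X x \<N>}. \<forall>r' \<in> {|\<N>| |\<N>. i_network X x \<N>}. r \<le>o r'"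
    by (rule exists_minim_Card_order)
  then have "\<exists>\<kappa>. (\<exists>\<N>. i_network X x \<N> \<and> \<kappa> = |\<N>| ) \<and>
                 (\<forall>\<N>. i_network X x \<N> \<longrightarrow> \<kappa> \<le>o |\<N>| )"
    by blast
  from someI_ex[OF this] show ?thesis
    using assms by (simp add: nw_chi_def)
qed

end

(* If some non-isolated point x has a neighborhood whose other points are all isolated, then by
   compactness any countably infinite set D of such points, taken in a small enough closed
   neighborhood, converges to x, and the cofinite subsets of D form a countable i-network at x.
   Otherwise the closed set of non-isolated points has no isolated points in its subspace topology
   and so carries a Cantor scheme: a countable family of nonempty closed sets, each of which
   contains two disjoint members of the family. Zorn's lemma yields a maximal open set U that
   contains no member of the family. The sets C - U with C in the family are infinite, and by
   maximality they form an i-network at every point outside U. *)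

theory Submission
  imports Defs "HOL-Library.Countable_Set_Type"
begin

text \<open>Remove from the space one point other than \<open>x\<close> of each member of a finite
  family. Finite sets are closed in a T1 space, so what remains is a neighborhood of
  \<open>x\<close>, yet it contains no member. This makes aleph_0 a lower bound for
  \<open>nw_chi\<close>.\<close>

lemma infinite_i_network:
  assumes "t1_space X" "x \<in> topspace X" "i_network X x \<N>"
  shows "infinite \<N>"
proof
  assume fin: "finite \<N>"
  have "\<exists>y. y \<in> N - {x}" if "N \<in> \<N>" for N
  proof -
    have "infinite (N - {x})"
      using assms(3) that by (simp add: i_network_def)
    then show ?thesis
      by (metis finite.emptyI all_not_in_conv)
  qed
  then obtain f where f: "\<And>N. N \<in> \<N> \<Longrightarrow> f N \<in> N - {x}"
    by metis
  have "f ` \<N> \<subseteq> topspace X"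
    using f assms(3) by (fastforce simp: i_network_def)
  then have "closedin X (f ` \<N>)"
    using assms(1) fin by (simp add: t1_space_closedin_finite)
  then have "openin X (topspace X - f ` \<N>)"
    by blast
  moreover have "x \<in> topspace X - f ` \<N>"
    using assms(2) f by blast
  ultimately have "neighborhood X x (topspace X - f ` \<N>)"
    by (simp add: neighborhood_def interior_of_openin)
  then obtain N where "N \<in> \<N>" "N \<subseteq> topspace X - f ` \<N>"
    using assms(3) unfolding i_network_def by blast
  then show False
    using f by blast
qed

lemma nw_chi_eq_natLeq:
  assumes "t1_space X" "x \<in> topspace X" "i_network X x \<N>" "countable \<N>"
  shows "nw_chi X x =o natLeq"
proof -
  \<comment> \<open>Every neighborhood contains an infinite member of \<open>\<N>\<close>, so the
    default value 1 in the definition of \<open>nw_chi\<close> does not occur.\<close>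
  have "\<forall>V. neighborhood X x V \<longrightarrow> infinite V"
    using assms(3) unfolding i_network_def by (meson finite_subset)
  from nw_chi_least[OF this] obtain \<M> where
    M: "i_network X x \<M>" "nw_chi X x = |\<M>|" and le: "nw_chi X x \<le>o |\<N>|"
    using assms(3) by blast
  have "natLeq \<le>o nw_chi X x"
    using infinite_i_network[OF assms(1,2) M(1)] M(2) by (metis infinite_iff_natLeq_ordLeq)
  moreover have "nw_chi X x \<le>o natLeq"
    using le assms(4) ordLeq_transitive by (auto simp: countable_card_le_natLeq)
  ultimately show ?thesis
    by (simp add: ordIso_iff_ordLeq)
qed

lemma i_networkI:
  assumes "\<And>N. N \<in> \<N> \<Longrightarrow> N \<subseteq> topspace X" "\<And>N. N \<in> \<N> \<Longrightarrow> infinite N"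
    and "\<And>V. openin X V \<Longrightarrow> x \<in> V \<Longrightarrow> \<exists>N\<in>\<N>. N \<subseteq> V"
  shows "i_network X x \<N>"
proof -
  have "\<exists>N\<in>\<N>. N \<subseteq> V" if "x \<in> X interior_of V" for V
    using assms(3)[of "X interior_of V"] that interior_of_subset[of X V] by auto
  then show ?thesis
    using assms(1,2) by (auto simp: i_network_def neighborhood_def)
qed

text \<open>The trace on \<open>S\<close> of an open set around \<open>x\<close> is a neighborhood
  of \<open>x\<close> in the subspace. This allows a network to be built inside the set of
  non-isolated points.\<close>

lemma i_network_subtopology:
  assumes "i_network (subtopology X S) x \<N>" "x \<in> S"
  shows "i_network X x \<N>"
proof (rule i_networkI)
  fix N assume "N \<in> \<N>"
  then have "N \<in> Pow (topspace (subtopology X S))" "infinite N"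
    using assms(1) by (meson i_network_def subsetD)+
  then show "N \<subseteq> topspace X" "infinite N"
    by auto
next
  fix V assume "openin X V" "x \<in> V"
  then have "openin (subtopology X S) (S \<inter> V)"
    by (simp add: openin_subtopology_Int2)
  then have "neighborhood (subtopology X S) x (S \<inter> V)"
    using \<open>x \<in> V\<close> assms(2) by (simp add: neighborhood_def interior_of_openin openin_subset del: topspace_subtopology)
  then obtain N where "N \<in> \<N>" "N \<subseteq> S \<inter> V"
    using assms(1) by (meson i_network_def)
  then show "\<exists>N\<in>\<N>. N \<subseteq> V"
    by blast
qed

lemma countable_i_network_relatively_isolated:
  assumes "compact_space X" "Hausdorff_space X"
    and U: "openin X U" "U \<inter> X derived_set_of topspace X = {x}"
  shows "\<exists>\<N>. countable \<N> \<and> i_network X x \<N>"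
proof -
  have xU: "x \<in> U" "x \<in> X derived_set_of topspace X"
    using U by auto
  have "regular_space X"
    using assms by (simp add: compact_Hausdorff_imp_regular_space)
  \<comment> \<open>The compact set \<open>K\<close> will capture accumulation points of subsets of
    \<open>V\<close> while keeping them in \<open>U\<close>, where \<open>x\<close> is the only
    non-isolated point.\<close>
  then obtain V K where V: "openin X V" "closedin X K" "x \<in> V" "V \<subseteq> K" "K \<subseteq> U"
    using U xU unfolding neighbourhood_base_of_closedin[symmetric] neighbourhood_base_of by meson
  have "t1_space X"
    using assms(2) by (rule Hausdorff_imp_t1_space)
  then have "infinite (topspace X \<inter> V)"
    using xU(2) V unfolding t1_space_derived_set_of_infinite_openin by blast
  then have "infinite (V - {x})"
    by (metis Int_lower2 finite_Diff2 finite.emptyI finite.insertI finite_subset)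
  then obtain D where D: "D \<subseteq> V - {x}" "countable D" "infinite D"
    by (meson infinite_countable_subset')
  have DX: "D \<subseteq> topspace X"
    using D V openin_subset by fastforce
  let ?N = "(\<lambda>F. D - F) ` {F. finite F \<and> F \<subseteq> D}"
  have "countable ?N"
    using D by (intro countable_image countable_Collect_finite_subset)
  moreover have "i_network X x ?N"
  proof (rule i_networkI)
    fix W assume W: "openin X W" "x \<in> W"
    \<comment> \<open>Otherwise \<open>D - W\<close> accumulates at some \<open>p\<close> in
      \<open>K\<close>. Being non-isolated and in \<open>U\<close>, \<open>p\<close> equals
      \<open>x\<close>, but \<open>W\<close> is an open set around \<open>x\<close> that misses
      \<open>D - W\<close>.\<close>
    have "finite (D - W)"
    proof (rule ccontr)
      assume "infinite (D - W)"
      moreover have "compactin X K"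
        using V assms closedin_compact_space by blast
      ultimately obtain p where p: "p \<in> K" "p \<in> X derived_set_of (D - W)"
        using compactin_imp_Bolzano_Weierstrass[of X K "D - W"] D V by blast
      then have "p \<in> X derived_set_of topspace X"
        using DX derived_set_of_mono[of "D - W" "topspace X" X] by blast
      then have "p = x"
        using p V U by blast
      then show False
        using p W by (auto simp: in_derived_set_of)
    qed
    then show "\<exists>N\<in>?N. N \<subseteq> W"
      by (intro bexI[of _ "D - (D - W)"]) auto
  qed (use D DX in auto)
  ultimately show ?thesis by blast
qed

text \<open>Descent on cardinality: \<open>f B\<close> is nonempty and disjoint from
  \<open>f A\<close>, so \<open>f A\<close> is a proper subset of \<open>f C\<close>. The map
  \<open>f\<close> allows sets \<open>C - U\<close> to be treated while the splitting is indexed by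
  the sets \<open>C\<close>.\<close>

lemma infinite_if_splits:
  assumes "C \<in> \<C>" "{} \<notin> f ` \<C>"
    and "\<And>C. C \<in> \<C> \<Longrightarrow> \<exists>A\<in>\<C>. \<exists>B\<in>\<C>. f A \<subseteq> f C \<and> f B \<subseteq> f C \<and> disjnt (f A) (f B)"
  shows "infinite (f C)"
proof
  assume "finite (f C)"
  then show False
    using \<open>C \<in> \<C>\<close>
  proof (induction "card (f C)" arbitrary: C rule: less_induct)
    case less
    obtain A B where AB: "A \<in> \<C>" "B \<in> \<C>" "f A \<subseteq> f C" "f B \<subseteq> f C" "disjnt (f A) (f B)"
      using assms(3) less.prems by meson
    have "f B \<noteq> {}"
      using assms(2) AB by force
    then have "f A \<subset> f C"
      using AB unfolding disjnt_def by blast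
    then show False
      using less AB by (meson finite_subset psubset_card_mono)
  qed
qed

lemma countable_i_network_scheme:
  assumes "compact_space X" "countable \<C>" "\<C> \<noteq> {}" "{} \<notin> \<C>"
    and closed: "\<And>C. C \<in> \<C> \<Longrightarrow> closedin X C"
    and split: "\<And>C. C \<in> \<C> \<Longrightarrow> \<exists>A\<in>\<C>. \<exists>B\<in>\<C>. A \<subseteq> C \<and> B \<subseteq> C \<and> disjnt A B"
  shows "\<exists>x\<in>topspace X. \<exists>\<N>. countable \<N> \<and> i_network X x \<N>"
proof -
  let ?A = "{U. openin X U \<and> (\<forall>C\<in>\<C>. \<not> C \<subseteq> U)}"
  have "\<exists>U\<in>?A. \<forall>W\<in>?A. U \<subseteq> W \<longrightarrow> W = U"
  proof (rule subset_Zorn_nonempty)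
    show "?A \<noteq> {}"
      using assms(4) by (auto intro!: exI[of _ "{}"])
  next
    fix \<B> assume B: "\<B> \<noteq> {}" "subset.chain ?A \<B>"
    have BA: "\<B> \<subseteq> ?A"
      using B(2) by (simp add: subset.chain_def)
    \<comment> \<open>A compact \<open>C\<close> covered by the chain is covered by a finite
      subchain, hence by its largest element, which contains no member of
      \<open>\<C>\<close>.\<close>
    have "\<not> C \<subseteq> \<Union>\<B>" if C: "C \<in> \<C>" for C
    proof
      assume "C \<subseteq> \<Union>\<B>"
      moreover have "compactin X C"
        using closed[OF C] assms(1) closedin_compact_space by blast
      ultimately obtain \<F> where F: "finite \<F>" "\<F> \<subseteq> \<B>" "C \<subseteq> \<Union>\<F>"
        using BA unfolding compactin_def by (metis (no_types, lifting) mem_Collect_eq subsetD)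
      have "\<F> \<noteq> {}"
        using F C assms(4) by auto
      moreover have "subset.chain ?A \<F>"
        using F(2) B(2) unfolding subset_chain_def by (metis (no_types, lifting) subsetD subset_trans)
      ultimately have "\<Union>\<F> \<in> \<F>"
        using F(1) Union_in_chain by blast
      then show False
        using F BA C by blast
    qed
    then show "\<Union>\<B> \<in> ?A"
      using BA by auto
  qed
  then obtain U where U: "openin X U" "\<And>C. C \<in> \<C> \<Longrightarrow> \<not> C \<subseteq> U"
    and max: "\<And>W. openin X W \<Longrightarrow> U \<subset> W \<Longrightarrow> \<exists>C\<in>\<C>. C \<subseteq> W"
    by (smt (verit, ccfv_threshold) mem_Collect_eq psubsetE)
  \<comment> \<open>Such a point exists because a member of \<open>\<C>\<close> lies in the space
    but not in \<open>U\<close>.\<close>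
  obtain x where x: "x \<in> topspace X" "x \<notin> U"
    using assms(3) U closed closedin_subset by (metis ex_in_conv subset_iff)
  have "i_network X x ((\<lambda>C. C - U) ` \<C>)"
  proof (rule i_networkI)
    show "N \<subseteq> topspace X" if "N \<in> (\<lambda>C. C - U) ` \<C>" for N
      using that closed closedin_subset by blast
  next
    fix N assume "N \<in> (\<lambda>C. C - U) ` \<C>"
    then obtain C where C: "C \<in> \<C>" "N = C - U" by blast
    \<comment> \<open>Removing \<open>U\<close> preserves inclusions and disjointness, and leaves
      every member nonempty since none is contained in \<open>U\<close>.\<close>
    have "infinite (C - U)"
    proof (rule infinite_if_splits[where f="\<lambda>C. C - U"])
      show "C \<in> \<C>" by fact
      show "{} \<notin> (\<lambda>C. C - U) ` \<C>" using U(2) by blast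
      show "\<exists>A\<in>\<C>. \<exists>B\<in>\<C>. A - U \<subseteq> C - U \<and> B - U \<subseteq> C - U \<and> disjnt (A - U) (B - U)"
        if C: "C \<in> \<C>" for C
      proof -
        obtain A B where "A \<in> \<C>" "B \<in> \<C>" "A \<subseteq> C" "B \<subseteq> C" "disjnt A B"
          using split[OF C] by metis
        then show ?thesis
          by (intro bexI[of _ A] bexI[of _ B]) (auto simp: disjnt_iff)
      qed
    qed
    then show "infinite N" using C by simp
  next
    fix V assume V: "openin X V" "x \<in> V"
    \<comment> \<open>The point \<open>x\<close> makes \<open>U \<union> V\<close> strictly larger
      than \<open>U\<close>, so maximality applies.\<close>
    then obtain C where "C \<in> \<C>" "C \<subseteq> U \<union> V"
      using max[of "U \<union> V"] U(1) x by blast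
    then have "C - U \<subseteq> V" by auto
    with \<open>C \<in> \<C>\<close> show "\<exists>N\<in>(\<lambda>C. C - U) ` \<C>. N \<subseteq> V"
      by (meson imageI)
  qed
  then show ?thesis
    using x(1) assms(2) countable_image by metis
qed

text \<open>The branching step of the Cantor scheme: a non-isolated point of \<open>U\<close> has a
  second point of \<open>U\<close> beside it, the Hausdorff property separates the two, and
  regularity shrinks the separating sets to ones with closures inside them.\<close>

lemma open_split:
  assumes "regular_space X" "Hausdorff_space X" "topspace X \<subseteq> X derived_set_of topspace X"
    and U: "openin X U" "U \<noteq> {}"
  shows "\<exists>V W. openin X V \<and> V \<noteq> {} \<and> X closure_of V \<subseteq> U \<and> openin X W \<and> W \<noteq> {} \<and>
    X closure_of W \<subseteq> U \<and> disjnt (X closure_of V) (X closure_of W)"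
proof -
  obtain a where a: "a \<in> U" "a \<in> X derived_set_of topspace X"
    using U assms(3) openin_subset by blast
  then obtain b where b: "b \<in> U" "b \<noteq> a"
    using U(1) by (metis in_derived_set_of)
  obtain A B where AB: "openin X A" "openin X B" "a \<in> A" "b \<in> B" "disjnt A B"
  proof -
    have "a \<in> topspace X" "b \<in> topspace X"
      using a b U(1) openin_subset by blast+
    then show ?thesis
      using that assms(2) b(2) unfolding Hausdorff_space_def by metis
  qed
  have shrink: "\<exists>V. openin X V \<and> y \<in> V \<and> X closure_of V \<subseteq> G" if G: "openin X G" "y \<in> G" for y G
  proof -
    obtain V K where "openin X V" "closedin X K" "y \<in> V" "V \<subseteq> K" "K \<subseteq> G"
      using assms(1) G unfolding neighbourhood_base_of_closedin[symmetric] neighbourhood_base_of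
      by meson
    then show ?thesis
      using closure_of_minimal[of V K X] by blast
  qed
  obtain V where V: "openin X V" "a \<in> V" "X closure_of V \<subseteq> U \<inter> A"
    using shrink[of "U \<inter> A" a] AB a U by blast
  obtain W where W: "openin X W" "b \<in> W" "X closure_of W \<subseteq> U \<inter> B"
    using shrink[of "U \<inter> B" b] AB b U by blast
  have "disjnt (X closure_of V) (X closure_of W)"
    using V W AB(5) unfolding disjnt_def by blast
  then show ?thesis
    using V W by blast
qed

lemma countable_i_network_dense_in_itself:
  assumes "compact_space X" "Hausdorff_space X" "topspace X \<noteq> {}"
    and perfect: "topspace X \<subseteq> X derived_set_of topspace X"
  shows "\<exists>x\<in>topspace X. \<exists>\<N>. countable \<N> \<and> i_network X x \<N>"
proof -
  have reg: "regular_space X"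
    using assms by (simp add: compact_Hausdorff_imp_regular_space)
  obtain l r where lr: "\<And>U. openin X U \<Longrightarrow> U \<noteq> {} \<Longrightarrow>
      openin X (l U) \<and> l U \<noteq> {} \<and> X closure_of l U \<subseteq> U \<and> openin X (r U) \<and> r U \<noteq> {} \<and>
      X closure_of r U \<subseteq> U \<and> disjnt (X closure_of l U) (X closure_of r U)"
    using open_split[OF reg assms(2) perfect] by metis
  \<comment> \<open>The open set at node \<open>bs\<close> of the binary tree, with the whole space
    at the root. The head of the list is the latest choice, so \<open>b # bs\<close> is a child of
    \<open>bs\<close>.\<close>
  define G where "G bs = foldr (\<lambda>b. if b then l else r) bs (topspace X)" for bs
  have G: "openin X (G bs) \<and> G bs \<noteq> {}" for bs
    by (induction bs) (use lr assms(3) in \<open>auto simp: G_def\<close>)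
  have sub: "G bs \<subseteq> X closure_of G bs" for bs
    using G by (simp add: closure_of_subset openin_subset)
  have split: "X closure_of G (b # bs) \<subseteq> G bs"
    "disjnt (X closure_of G (True # bs)) (X closure_of G (False # bs))" for b bs
    using lr[of "G bs"] G[of bs] by (auto simp: G_def)
  show ?thesis
  \<comment> \<open>The open sets \<open>G bs\<close> drive the recursion; their closures, indexed
    by the countably many boolean lists, form the scheme.\<close>
  proof (rule countable_i_network_scheme[OF assms(1)])
    show "countable (range (\<lambda>bs. X closure_of G bs))"
      by simp
    show "range (\<lambda>bs. X closure_of G bs) \<noteq> {}"
      by simp
    show "{} \<notin> range (\<lambda>bs. X closure_of G bs)"
    proof
      assume "{} \<in> range (\<lambda>bs. X closure_of G bs)"
      then obtain bs where "X closure_of G bs = {}"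
        by auto
      then show False
        using G[of bs] sub[of bs] by simp
    qed
    show "closedin X C" if "C \<in> range (\<lambda>bs. X closure_of G bs)" for C
      using that by auto
    show "\<exists>A\<in>range (\<lambda>bs. X closure_of G bs). \<exists>B\<in>range (\<lambda>bs. X closure_of G bs).
        A \<subseteq> C \<and> B \<subseteq> C \<and> disjnt A B" if C: "C \<in> range (\<lambda>bs. X closure_of G bs)" for C
    proof -
      obtain bs where bs: "C = X closure_of G bs"
        using C by auto
      have "X closure_of G (b # bs) \<subseteq> C" for b
        using split(1) sub unfolding bs by (rule order_trans)
      then show ?thesis
        using split(2)[of bs] by (meson rangeI)
    qed
  qed
qed

theorem theorem3:
  fixes X :: "'a topology"
  assumes "compact_space X" and "Hausdorff_space X" and "infinite (topspace X)"
  shows "\<exists>x\<in>topspace X. nw_chi X x =o natLeq"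
proof -
  define P where "P = X derived_set_of topspace X"
  have PX: "P \<subseteq> topspace X"
    by (simp add: P_def derived_set_of_subset_topspace)
  have "\<exists>x\<in>topspace X. \<exists>\<N>. countable \<N> \<and> i_network X x \<N>"
  \<comment> \<open>The case distinction is whether \<open>P\<close>, as a subspace, has an isolated
    point.\<close>
  proof (cases "\<exists>x U. openin X U \<and> U \<inter> P = {x}")
    case True
    then show ?thesis
      using countable_i_network_relatively_isolated[OF assms(1,2)] PX unfolding P_def
      by (metis Int_iff insertI1 subsetD)
  next
    case False
    have topP: "topspace (subtopology X P) = P"
      using PX by auto
    have "closedin X P"
      by (simp add: P_def closedin_derived_set_of_gen Hausdorff_imp_t1_space assms(2))
    then have "compact_space (subtopology X P)"
      using assms(1) closedin_compact_space compact_space_subtopology by blast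
    moreover have "Hausdorff_space (subtopology X P)"
      using assms(2) by (rule Hausdorff_space_subtopology)
    \<comment> \<open>An infinite compact space has an accumulation point.\<close>
    moreover have "P \<noteq> {}"
      using compactin_imp_Bolzano_Weierstrass[of X "topspace X" "topspace X"] assms
      by (auto simp: P_def compact_space_def)
    moreover have "P \<subseteq> subtopology X P derived_set_of P"
    proof -
      \<comment> \<open>An open singleton of the subspace would be a trace
        \<open>U \<inter> P = {x}\<close>, which this case excludes.\<close>
      have "\<not> openin (subtopology X P) {x}" for x
        using False by (metis openin_subtopology)
      then show ?thesis
        using derived_set_of_topspace[of "subtopology X P"] unfolding topP by blast
    qed
    ultimately obtain x \<N> where "x \<in> P" "countable \<N>" "i_network (subtopology X P) x \<N>"
      using countable_i_network_dense_in_itself[of "subtopology X P"] unfolding topP by blast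
    then show ?thesis
      using i_network_subtopology[of X P x \<N>] PX by (meson subsetD)
  qed
  then show ?thesis
    using nw_chi_eq_natLeq[OF Hausdorff_imp_t1_space[OF assms(2)]] by meson
qed

end
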